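(* The map $w\mapsto N(w)$ from $A^*$ to the set of $N$-tableaux on $A$ induces a well-defined bijection from the stylic monoid $\mathrm{Styl}(A)$ onto the set of all $N$-tableaux on $A$. That is, for $u,v\in A^*$ one has $N(u)=N(v)$ if and only if $u\equiv_{styl}v$, and every $N$-tableau on $A$ equals $N(w)$ for some $w\in A^*$.
   Context: $A$ is a finite totally ordered alphabet and $A^*$ the free monoid on $A$. A column is a subset of $A$, identified with the strictly decreasing word of its elements. For a column $\gamma$ and a letter $x$: if $x>y$ for all $y\in\gamma$, let $x\cdot\gamma=\gamma\cup\{x\}$; otherwise let $y$ be the smallest element of $\gamma$ with $y\geq x$ and let $x\cdot\gamma=(\gamma\setminus\{y\})\cup\{x\}$. This extends to a left action of $A^*$ on the set $\mathcal C(A)$ of columns by $(uv)\cdot\gamma=u\cdot(v\cdot\gamma)$ (the empty word acts trivially). $\mathrm{Styl}(A)$ is the monoid of maps $\mathcal C(A)\to\mathcal C(A)$ induced by words, and $u\equiv_{styl}v$ means $u\cdot\gamma=v\cdot\gamma$ for all columns $\gamma$. Tableaux are drawn in French convention: rows are numbered from the bottom (row 1 at the bottom), entries weakly increase left to right in rows and strictly increase bottom to top in columns. An $N$-tableau is a tableau whose rows are strictly increasing and in which each row, viewed as a subset of $A$, is contained in the row below it. $N$-insertion: for a strictly increasing row $B$ (a subset of $A$) and a letter $x$, the $N$-insertion of $x$ into $B$ produces the row $B\cup\{x\}$, and if there is a smallest element $y$ of $B$ strictly larger than $x$, a copy of $y$ is bumped (otherwise nothing is bumped). $N$-insertion of $x$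 into an $N$-tableau $T$: insert $x$ into the first row; if a letter is bumped, $N$-insert it into the second row (creating a new row if necessary), and so on until nothing is bumped. For a word $w=a_1\cdots a_n$, $N(w)$ is obtained from the empty tableau by $N$-inserting successively $a_1,a_2,\ldots,a_n$. *)

theory Defs
  imports "HOL-Algebra.Group"
begin

text \<open>
  The alphabet is a finite set \<open>A\<close> of a linearly ordered type; words are elements of
  \<open>lists A\<close>. Columns are kept as subsets of \<open>A\<close>.
\<close>

definition columns :: "'a::linorder set \<Rightarrow> 'a set set" where
  "columns A = Pow A"

definition letter_act :: "'a::linorder \<Rightarrow> 'a set \<Rightarrow> 'a set" where
  "letter_act x \<gamma> =
     (if \<forall>y\<in>\<gamma>. y < x then \<gamma> \<union> {x}
      else (\<gamma> - {Min {y \<in> \<gamma>. x \<le> y}}) \<union> {x})"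

text \<open>A left action: the last letter of the word acts first.\<close>

definition word_act :: "'a::linorder list \<Rightarrow> 'a set \<Rightarrow> 'a set" where
  "word_act w \<gamma> = foldr letter_act w \<gamma>"

definition styl_equiv :: "'a::linorder set \<Rightarrow> 'a list \<Rightarrow> 'a list \<Rightarrow> bool" where
  "styl_equiv A u v \<longleftrightarrow> (\<forall>\<gamma>\<in>columns A. word_act u \<gamma> = word_act v \<gamma>)"

text \<open>
  Maps from \<open>columns A\<close> to itself are represented extensionally (undefined outside of
  \<open>columns A\<close>), so that equality of such maps is equality on \<open>columns A\<close>.
\<close>

definition styl_map :: "'a::linorder set \<Rightarrow> 'a list \<Rightarrow> 'a set \<Rightarrow> 'a set" where
  "styl_map A w = restrict (word_act w) (columns A)"

definition Styl :: "'a::linorder set \<Rightarrow> ('a set \<Rightarrow> 'a set) monoid" where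
  "Styl A = \<lparr>carrier = styl_map A ` lists A,
             mult = compose (columns A),
             one = restrict id (columns A)\<rparr>"

text \<open>
  A tableau is the list of its rows from bottom to top (French convention), each row being
  read from left to right. Empty rows are excluded, so that a tableau has only one representation.
\<close>

definition tableau :: "'a::linorder list list \<Rightarrow> bool" where
  "tableau T \<longleftrightarrow>
     (\<forall>r\<in>set T. r \<noteq> [] \<and> sorted r) \<and>
     (\<forall>i. Suc i < length T \<longrightarrow>
        length (T ! Suc i) \<le> length (T ! i) \<and>
        (\<forall>j < length (T ! Suc i). T ! i ! j < T ! Suc i ! j))"

definition N_tableau :: "'a::linorder list list \<Rightarrow> bool" where
  "N_tableau T \<longleftrightarrow>
     tableau T \<and>
     (\<forall>r\<in>set T. sorted_wrt (<) r) \<and>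
     (\<forall>i. Suc i < length T \<longrightarrow> set (T ! Suc i) \<subseteq> set (T ! i))"

definition N_tableaux :: "'a::linorder set \<Rightarrow> 'a list list set" where
  "N_tableaux A = {T \<in> lists (lists A). N_tableau T}"

definition row_insert :: "'a::linorder \<Rightarrow> 'a list \<Rightarrow> 'a list" where
  "row_insert x B = sorted_list_of_set (set B \<union> {x})"

definition row_bump :: "'a::linorder \<Rightarrow> 'a list \<Rightarrow> 'a option" where
  "row_bump x B =
     (if \<exists>y\<in>set B. x < y then Some (Min {y \<in> set B. x < y}) else None)"

fun N_insert :: "'a::linorder \<Rightarrow> 'a list list \<Rightarrow> 'a list list" where
  "N_insert x [] = [row_insert x []]"
| "N_insert x (B # T) =
     row_insert x B # (case row_bump x B of None \<Rightarrow> T | Some y \<Rightarrow> N_insert y T)"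

definition N_tab :: "'a::linorder list \<Rightarrow> 'a list list" where
  "N_tab w = fold N_insert w []"

lemma letter_act_in_columns:
  assumes "finite A" "x \<in> A" "\<gamma> \<in> columns A"
  shows "letter_act x \<gamma> \<in> columns A"
  using assms unfolding letter_act_def columns_def by auto

lemma word_act_in_columns:
  assumes "finite A" "w \<in> lists A" "\<gamma> \<in> columns A"
  shows "word_act w \<gamma> \<in> columns A"
  using assms(2,3) unfolding word_act_def
  by (induction w) (auto intro: letter_act_in_columns[OF assms(1)])

lemma styl_map_append:
  assumes "finite A" "v \<in> lists A"
  shows "styl_map A (u @ v) = compose (columns A) (styl_map A u) (styl_map A v)"
  using word_act_in_columns[OF assms]
  unfolding styl_map_def compose_def
  by (auto simp: fun_eq_iff word_act_def restrict_def)

lemma styl_map_Nil: "styl_map A [] = restrict id (columns A)"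
  unfolding styl_map_def by (auto simp: fun_eq_iff word_act_def restrict_def)

lemma monoid_Styl:
  assumes "finite A"
  shows "monoid (Styl A)"
proof (rule monoidI)
  fix f g assume "f \<in> carrier (Styl A)" "g \<in> carrier (Styl A)"
  then obtain u v where "u \<in> lists A" "f = styl_map A u" "v \<in> lists A" "g = styl_map A v"
    unfolding Styl_def by auto
  then have "f \<otimes>\<^bsub>Styl A\<^esub> g = styl_map A (u @ v)" "u @ v \<in> lists A"
    by (auto simp: Styl_def styl_map_append[OF assms])
  then show "f \<otimes>\<^bsub>Styl A\<^esub> g \<in> carrier (Styl A)"
    by (auto simp: Styl_def)
next
  show "\<one>\<^bsub>Styl A\<^esub> \<in> carrier (Styl A)"
    unfolding Styl_def by (auto simp: styl_map_Nil[symmetric])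
next
  fix f g h
  assume "f \<in> carrier (Styl A)" "g \<in> carrier (Styl A)" "h \<in> carrier (Styl A)"
  then obtain u v w where "u \<in> lists A" "f = styl_map A u" "v \<in> lists A" "g = styl_map A v"
      "w \<in> lists A" "h = styl_map A w"
    unfolding Styl_def by auto
  then show "f \<otimes>\<^bsub>Styl A\<^esub> g \<otimes>\<^bsub>Styl A\<^esub> h = f \<otimes>\<^bsub>Styl A\<^esub> (g \<otimes>\<^bsub>Styl A\<^esub> h)"
    by (simp add: Styl_def styl_map_append[OF assms, symmetric])
next
  fix f assume "f \<in> carrier (Styl A)"
  then obtain u where "u \<in> lists A" "f = styl_map A u"
    unfolding Styl_def by auto
  then show "\<one>\<^bsub>Styl A\<^esub> \<otimes>\<^bsub>Styl A\<^esub> f = f" "f \<otimes>\<^bsub>Styl A\<^esub> \<one>\<^bsub>Styl A\<^esub> = f"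
    by (simp_all add: Styl_def styl_map_Nil[symmetric] styl_map_append[OF assms, symmetric])
qed

end

theory Submission
  imports Defs "HOL-Library.Sublist"
begin

text \<open>
  The stylic class of \<open>w\<close> and the tableau \<open>N(w)\<close> both encode the same data: the lengths \<open>D(S)\<close>
  of the longest strictly decreasing subsequences of \<open>w\<close> with letters in an order-convex set \<open>S\<close>.
  As in Greene's theorem, \<open>w \<cdot> \<gamma>\<close> has as many letters below \<open>t\<close> as the longest strictly decreasing
  subsequence of the word \<open>w \<gamma>\<close> below \<open>t\<close>, so the action is determined by \<open>D\<close>; letting
  \<open>\<gamma>\<close> run through initial segments of \<open>A\<close> recovers \<open>D\<close>. On the other side, an insertion step
  replaces \<open>B x\<close> by \<open>y B'\<close> with the same \<open>D\<close>, so \<open>w\<close> and the row word of \<open>N(w)\<close> have the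
  same \<open>D\<close>. Finally a letter \<open>m\<close> lies in row \<open>k\<close> of an \<open>N\<close>-tableau if and only if
  \<open>D[z, m) < k \<le> D[z, m]\<close> for some \<open>z\<close>, so an \<open>N\<close>-tableau is determined by the \<open>D\<close> of its row word.
\<close>

section \<open>Decreasing subsequences\<close>

text \<open>Convexity is what insertion respects: if \<open>y\<close> is bumped,
  \<open>B @ [x]\<close> and \<open>y # row_insert x B\<close> need not have the same
  \<open>max_dec\<close> on a set that contains \<open>x\<close> and some \<open>b > y\<close> but
  not \<open>y\<close>.\<close>

definition order_convex :: "'a::linorder set \<Rightarrow> bool" where
  "order_convex S \<longleftrightarrow> (\<forall>a\<in>S. \<forall>b\<in>S. {a..b} \<subseteq> S)"

lemma order_convexD: "order_convex S \<Longrightarrow> a \<in> S \<Longrightarrow> b \<in> S \<Longrightarrow> a \<le> c \<Longrightarrow> c \<le> b \<Longrightarrow> c \<in> S"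
  unfolding order_convex_def by (meson atLeastAtMost_iff subsetD)

lemma order_convex_Int: "order_convex S \<Longrightarrow> order_convex S' \<Longrightarrow> order_convex (S \<inter> S')"
  unfolding order_convex_def by blast

lemma order_convex_intervals [simp]:
  "order_convex {a..}" "order_convex {..<a}" "order_convex {a..b}" "order_convex {a..<b}"
  unfolding order_convex_def by auto

definition dec_subseqs :: "'a::linorder list \<Rightarrow> 'a set \<Rightarrow> 'a list set" where
  "dec_subseqs w S = {c. subseq c w \<and> sorted_wrt (>) c \<and> set c \<subseteq> S}"

text \<open>Schensted's invariant for decreasing subsequences, localised to \<open>S\<close>. The
  empty sequence always competes, so \<open>Max\<close> is never taken of an empty set.\<close>

definition max_dec :: "'a::linorder list \<Rightarrow> 'a set \<Rightarrow> nat" where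
  "max_dec w S = Max (length ` dec_subseqs w S)"

definition dec_equiv :: "'a::linorder list \<Rightarrow> 'a list \<Rightarrow> bool" where
  "dec_equiv u v \<longleftrightarrow> (\<forall>S. order_convex S \<longrightarrow> max_dec u S = max_dec v S)"

lemma Nil_in_dec_subseqs [simp]: "[] \<in> dec_subseqs w S"
  by (simp add: dec_subseqs_def)

lemma dec_subseqs_Nil [simp]: "dec_subseqs [] S = {[]}"
  by (auto simp: dec_subseqs_def dest: list_emb_Nil2)

lemma finite_dec_subseqs: "finite (dec_subseqs w S)"
proof (rule finite_subset)
  show "dec_subseqs w S \<subseteq> set (subseqs w)"
    by (auto simp: dec_subseqs_def)
qed simp

lemma le_max_dec_iff: "k \<le> max_dec w S \<longleftrightarrow> (\<exists>c\<in>dec_subseqs w S. k \<le> length c)"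
  unfolding max_dec_def
  by (subst Max_ge_iff) (auto simp: finite_dec_subseqs intro: Nil_in_dec_subseqs)

lemma length_le_max_dec: "c \<in> dec_subseqs w S \<Longrightarrow> length c \<le> max_dec w S"
  using le_max_dec_iff by blast

lemma max_dec_witness: obtains c where "c \<in> dec_subseqs w S" "length c = max_dec w S"
proof -
  obtain c where "c \<in> dec_subseqs w S" "max_dec w S \<le> length c"
    using le_max_dec_iff[of "max_dec w S" w S] by auto
  then show thesis
    using that length_le_max_dec[of c w S] by (metis le_antisym)
qed

lemma max_dec_leI:
  assumes "\<And>c. c \<in> dec_subseqs u S \<Longrightarrow> length c \<le> n"
  shows "max_dec u S \<le> n"
  using assms max_dec_witness by metis

lemma dec_equiv_refl [simp]: "dec_equiv u u"
  by (simp add: dec_equiv_def)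

lemma dec_equiv_sym: "dec_equiv u v \<Longrightarrow> dec_equiv v u"
  by (simp add: dec_equiv_def)

lemma dec_equiv_trans [trans]: "dec_equiv u v \<Longrightarrow> dec_equiv v w \<Longrightarrow> dec_equiv u w"
  by (simp add: dec_equiv_def)

lemma dec_equivE:
  assumes "dec_equiv u v" "order_convex S" "c \<in> dec_subseqs u S"
  obtains d where "d \<in> dec_subseqs v S" "length c \<le> length d"
proof -
  have "length c \<le> max_dec v S"
    using assms length_le_max_dec[OF assms(3)] by (simp add: dec_equiv_def)
  then show thesis
    using that le_max_dec_iff by blast
qed

lemma dec_subseqs_appendE:
  assumes "c \<in> dec_subseqs (u @ v) S"
  obtains c1 c2 where "c = c1 @ c2" "c1 \<in> dec_subseqs u S" "c2 \<in> dec_subseqs v S"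
    "\<forall>a\<in>set c1. \<forall>b\<in>set c2. b < a"
proof -
  from assms obtain c1 c2 where "c = c1 @ c2" "subseq c1 u" "subseq c2 v"
    unfolding dec_subseqs_def by (auto elim: subseq_appendE)
  with assms show thesis
    by (intro that[of c1 c2]) (auto simp: dec_subseqs_def sorted_wrt_append)
qed

text \<open>A threshold \<open>t\<close> separates the letters, so two pieces chosen independently
  of each other still glue to a decreasing sequence.\<close>

lemma dec_subseqs_appendI:
  assumes "c \<in> dec_subseqs u (S \<inter> {t..})" "d \<in> dec_subseqs v (S \<inter> {..<t})"
  shows "c @ d \<in> dec_subseqs (u @ v) S"
proof -
  have "subseq (c @ d) (u @ v)"
    using assms by (intro list_emb_append_mono) (auto simp: dec_subseqs_def)
  moreover have "t \<le> a" "b < t" if "a \<in> set c" "b \<in> set d" for a b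
    using assms that by (auto simp: dec_subseqs_def)
  then have "\<forall>a\<in>set c. \<forall>b\<in>set d. b < a"
    using order_less_le_trans by blast
  ultimately show ?thesis
    using assms by (simp add: dec_subseqs_def sorted_wrt_append)
qed

lemma last_le_if_dec:
  fixes c :: "'a::linorder list"
  assumes "sorted_wrt (>) c" "a \<in> set c"
  shows "last c \<le> a"
  using assms by (cases c rule: rev_cases) (auto simp: sorted_wrt_append less_imp_le)

text \<open>Split an optimal sequence as \<open>c1 @ c2\<close> and cut \<open>S\<close> at the last
  letter of \<open>c1\<close>. Both halves of \<open>S\<close> are convex, so each piece can be
  replaced separately by one that is no shorter, and the replacements glue.\<close>

lemma max_dec_append_le:
  assumes u: "dec_equiv u u'" and v: "dec_equiv v v'" and S: "order_convex S"
  shows "max_dec (u @ v) S \<le> max_dec (u' @ v') S"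
proof (rule max_dec_leI)
  fix c assume "c \<in> dec_subseqs (u @ v) S"
  then obtain c1 c2 where c: "c = c1 @ c2" "c1 \<in> dec_subseqs u S" "c2 \<in> dec_subseqs v S"
      "\<forall>a\<in>set c1. \<forall>b\<in>set c2. b < a"
    by (rule dec_subseqs_appendE)
  show "length c \<le> max_dec (u' @ v') S"
  \<comment> \<open>An empty \<open>c1\<close> has no last letter to cut at; then \<open>c2\<close>
    alone is replaced.\<close>
  proof (cases "c1 = []")
    case True
    obtain d where d: "d \<in> dec_subseqs v' S" "length c2 \<le> length d"
      using dec_equivE[OF v S c(3)] .
    then have "d \<in> dec_subseqs (u' @ v') S"
      by (simp add: dec_subseqs_def list_emb_append2)
    from length_le_max_dec[OF this] show ?thesis
      using d c(1) True by simp
  next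
    case False
    let ?t = "last c1"
    have "c1 \<in> dec_subseqs u (S \<inter> {?t..})"
      using c(2) last_le_if_dec by (auto simp: dec_subseqs_def)
    then obtain d1 where d1: "d1 \<in> dec_subseqs u' (S \<inter> {?t..})" "length c1 \<le> length d1"
      using dec_equivE[OF u order_convex_Int[OF S order_convex_intervals(1)]] by blast
    have "?t \<in> set c1"
      using False by simp
    then have "c2 \<in> dec_subseqs v (S \<inter> {..<?t})"
      using c(3,4) by (auto simp: dec_subseqs_def)
    then obtain d2 where d2: "d2 \<in> dec_subseqs v' (S \<inter> {..<?t})" "length c2 \<le> length d2"
      using dec_equivE[OF v order_convex_Int[OF S order_convex_intervals(2)]] by blast
    from length_le_max_dec[OF dec_subseqs_appendI[OF d1(1) d2(1)]] show ?thesis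
      using d1(2) d2(2) c(1) by simp
  qed
qed

lemma dec_equiv_append:
  "dec_equiv u u' \<Longrightarrow> dec_equiv v v' \<Longrightarrow> dec_equiv (u @ v) (u' @ v')"
  using max_dec_append_le dec_equiv_sym unfolding dec_equiv_def[of "u @ v"]
  by (metis le_antisym)

section \<open>Insertion and row words\<close>

text \<open>A subsequence of a row also increases, which leaves room for at most one letter.\<close>

lemma dec_subseq_of_row:
  assumes "sorted_wrt (<) B" "c \<in> dec_subseqs B S"
  obtains "c = []" | b where "c = [b]" "b \<in> set B" "b \<in> S"
proof -
  have c: "subseq c B" "sorted_wrt (>) c" "set c \<subseteq> S"
    using assms by (auto simp: dec_subseqs_def)
  have inc: "sorted_wrt (<) c"
    using c(1) assms(1) by induction (auto dest: list_emb_set)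
  show thesis
  proof (cases c)
    case Nil
    then show thesis using that by blast
  next
    case (Cons b d)
    then have "d = []"
      using inc c(2) by (cases d) auto
    then show thesis
      using that Cons c list_emb_set[OF c(1), of b] by auto
  qed
qed

text \<open>A decreasing subsequence of two rows takes at most one letter from each.\<close>

lemma max_dec_two_rows_le:
  fixes B :: "'a::linorder list"
  assumes B: "sorted_wrt (<) B" "sorted_wrt (<) B'"
    and support: "set B \<union> set B' \<subseteq> set w"
    and pairs: "\<And>b b'. b \<in> set B \<Longrightarrow> b' \<in> set B' \<Longrightarrow> b' < b \<Longrightarrow> {b, b'} \<subseteq> S \<Longrightarrow>
      \<exists>a a'. subseq [a, a'] w \<and> a' < a \<and> {a, a'} \<subseteq> S"
  shows "max_dec (B @ B') S \<le> max_dec w S"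
proof (rule max_dec_leI)
  fix c assume "c \<in> dec_subseqs (B @ B') S"
  then obtain c1 c2 where c: "c = c1 @ c2" "c1 \<in> dec_subseqs B S" "c2 \<in> dec_subseqs B' S"
      "\<forall>a\<in>set c1. \<forall>b\<in>set c2. b < a"
    by (rule dec_subseqs_appendE)
  have single: "1 \<le> max_dec w S" if "b \<in> set B \<union> set B'" "b \<in> S" for b
  proof -
    have "[b] \<in> dec_subseqs w S"
      using that support by (auto simp: dec_subseqs_def subseq_singleton_left)
    from length_le_max_dec[OF this] show ?thesis by simp
  qed
  consider "length c \<le> 0" | b where "length c = 1" "b \<in> set B \<union> set B'" "b \<in> S"
    | b b' where "length c = 2" "b \<in> set B" "b' \<in> set B'" "b' < b" "{b, b'} \<subseteq> S"
    using c(4) by (cases rule: dec_subseq_of_row[OF B(1) c(2)];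
        cases rule: dec_subseq_of_row[OF B(2) c(3)]) (auto simp: c(1))
  then show "length c \<le> max_dec w S"
  proof cases
    case 2
    with single show ?thesis by simp
  next
    case (3 b b')
    then obtain a a' where a: "subseq [a, a'] w" "a' < a" "{a, a'} \<subseteq> S"
      using pairs by blast
    then have "[a, a'] \<in> dec_subseqs w S"
      by (auto simp: dec_subseqs_def)
    from length_le_max_dec[OF this] show ?thesis using 3 by simp
  qed simp
qed

lemma sorted_row_insert [simp]: "sorted_wrt (<) (row_insert x B)"
  unfolding row_insert_def by (rule strict_sorted_list_of_set)

lemma set_row_insert [simp]: "set (row_insert x B) = insert x (set B)"
  unfolding row_insert_def by (subst set_sorted_list_of_set) auto

lemma row_insert_not_Nil [simp]: "row_insert x B \<noteq> []"
  using set_row_insert[of x B] by (metis insert_not_empty list.set(1))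

lemma row_bump_None_iff: "row_bump x B = None \<longleftrightarrow> (\<forall>b\<in>set B. b \<le> x)"
  by (auto simp: row_bump_def not_less[symmetric])

lemma row_bump_SomeD:
  assumes "row_bump x B = Some y"
  shows "y \<in> set B" "x < y" "\<And>b. b \<in> set B \<Longrightarrow> x < b \<Longrightarrow> y \<le> b"
proof -
  have y: "y = Min {y \<in> set B. x < y}" "{y \<in> set B. x < y} \<noteq> {}"
    using assms by (auto simp: row_bump_def split: if_splits)
  then show "y \<in> set B" "x < y"
    using Min_in[of "{y \<in> set B. x < y}"] by auto
  show "y \<le> b" if "b \<in> set B" "x < b" for b
    using y that by simp
qed

text \<open>Each word is a product of two rows, so only descents of length two have to be matched.
  When \<open>y\<close> is bumped, the pair \<open>[y, x]\<close> serves for every descent of either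
  word.\<close>

lemma dec_equiv_row_insert:
  assumes B: "sorted_wrt (<) B"
  shows "row_bump x B = None \<Longrightarrow> dec_equiv (B @ [x]) (row_insert x B)"
    and "row_bump x B = Some y \<Longrightarrow> dec_equiv (B @ [x]) (y # row_insert x B)"
proof -
  assume None: "row_bump x B = None"
  \<comment> \<open>Neither word has a descent here; the empty first factor only puts the single row
    into the two-row form.\<close>
  have "max_dec (B @ [x]) S = max_dec ([] @ row_insert x B) S" for S
    using B None by (intro le_antisym max_dec_two_rows_le) (auto simp: row_bump_None_iff)
  then show "dec_equiv (B @ [x]) (row_insert x B)"
    by (simp add: dec_equiv_def)
next
  assume "row_bump x B = Some y"
  note y = row_bump_SomeD[OF this]
  have "max_dec (B @ [x]) S \<le> max_dec ([y] @ row_insert x B) S" if S: "order_convex S" for S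
  proof (rule max_dec_two_rows_le)
    fix b b' assume "b \<in> set B" "b' \<in> set [x]" "b' < b" "{b, b'} \<subseteq> S"
    \<comment> \<open>Minimality of \<open>y\<close> gives \<open>x < y \<le> b\<close>, so
      \<open>y\<close> lies between two members of \<open>S\<close>.\<close>
    then have "{y, x} \<subseteq> S"
      using y order_convexD[OF S, of x b y] by auto
    moreover have "subseq [y, x] ([y] @ row_insert x B)"
      by (simp add: subseq_singleton_left)
    ultimately show "\<exists>a a'. subseq [a, a'] ([y] @ row_insert x B) \<and> a' < a \<and> {a, a'} \<subseteq> S"
      using y by blast
  qed (use B in auto)
  moreover have "max_dec ([y] @ row_insert x B) S \<le> max_dec (B @ [x]) S" if S: "order_convex S" for S
  proof (rule max_dec_two_rows_le)
    fix b b' assume *: "b \<in> set [y]" "b' \<in> set (row_insert x B)" "b' < b" "{b, b'} \<subseteq> S"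
    \<comment> \<open>A letter of \<open>B\<close> strictly between \<open>x\<close> and
      \<open>y\<close> would contradict the choice of \<open>y\<close>. Hence
      \<open>b' \<le> x < y\<close>, and convexity yields \<open>x\<close>.\<close>
    then have "b' \<le> x"
      using y(3)[of b'] by (auto simp: not_le[symmetric])
    then have "{y, x} \<subseteq> S"
      using * y order_convexD[OF S, of b' b x] by auto
    moreover have "subseq ([y] @ [x]) (B @ [x])"
      using y by (intro list_emb_append_mono) (auto simp: subseq_singleton_left)
    ultimately show "\<exists>a a'. subseq [a, a'] (B @ [x]) \<and> a' < a \<and> {a, a'} \<subseteq> S"
      using y by auto
  qed (use B y in auto)
  ultimately show "dec_equiv (B @ [x]) (y # row_insert x B)"
    unfolding dec_equiv_def by (auto intro: le_antisym)
qed

text \<open>Rows are stored from the bottom up, hence \<open>rev\<close>: the top row is read first,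
  so decreasing subsequences run from higher to lower rows.\<close>

definition row_word :: "'a list list \<Rightarrow> 'a list" where
  "row_word T = concat (rev T)"

lemma row_word_Cons [simp]: "row_word (B # T) = row_word T @ B"
  by (simp add: row_word_def)

text \<open>A bump turns the final \<open>B @ [x]\<close> of the word into
  \<open>y # row_insert x B\<close>; since the equivalence is a congruence, the induction hypothesis
  can then absorb \<open>y\<close> into the rows above.\<close>

lemma dec_equiv_N_insert:
  "\<forall>B\<in>set T. sorted_wrt (<) B \<Longrightarrow> dec_equiv (row_word (N_insert x T)) (row_word T @ [x])"
proof (induction x T rule: N_insert.induct)
  case (1 x)
  then show ?case by (simp add: row_word_def row_insert_def)
next
  case (2 x B T)
  show ?case
  proof (cases "row_bump x B")
    case None
    then show ?thesis
      using dec_equiv_append[OF dec_equiv_refl[of "row_word T"] dec_equiv_row_insert(1)] 2(2)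
      by (simp add: dec_equiv_sym)
  next
    case (Some y)
    have "dec_equiv (row_word T @ (B @ [x])) (row_word T @ (y # row_insert x B))"
      using 2(2) Some by (intro dec_equiv_append dec_equiv_row_insert) auto
    moreover have "dec_equiv (row_word (N_insert y T) @ row_insert x B)
        ((row_word T @ [y]) @ row_insert x B)"
      using 2 Some by (intro dec_equiv_append) auto
    ultimately show ?thesis
      using Some dec_equiv_trans dec_equiv_sym by fastforce
  qed
qed

section \<open>The shape of \<open>N\<close>-tableaux and its preservation under insertion\<close>

lemma subseq_nth_le_nth:
  fixes C D :: "'a::linorder list"
  assumes "subseq C D" "sorted_wrt (<) D" "j < length C"
  shows "D ! j \<le> C ! j"
  using assms
proof (induction arbitrary: j)
  case (list_emb_Nil D)
  then show ?case by simp
next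
  case (list_emb_Cons C D d)
  \<comment> \<open>The head \<open>d\<close> is skipped, so the hypothesis concerns position
    \<open>Suc j\<close> of \<open>d # D\<close>.\<close>
  have "(d # D) ! j < (d # D) ! Suc j"
    using list_emb_Cons.prems list_emb_length[OF list_emb_Cons.hyps]
    by (intro sorted_wrt_nth_less[of "(<)"]) auto
  also have "\<dots> \<le> C ! j"
    using list_emb_Cons by simp
  finally show ?case by simp
next
  case (list_emb_Cons2 c d C D)
  then show ?case by (cases j) auto
qed

text \<open>This removes positions from the definition of a tableau. If every letter of
  \<open>C\<close> has a smaller one in \<open>B\<close>, then \<open>C\<close> avoids the head of
  \<open>B\<close> and is a subsequence of its tail, so \<open>C ! j\<close> is at least
  \<open>B ! Suc j\<close>.\<close>

lemma row_above_iff: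
  fixes B C :: "'a::linorder list"
  assumes B: "sorted_wrt (<) B" and C: "sorted_wrt (<) C"
  shows "length C \<le> length B \<and> (\<forall>j<length C. B ! j < C ! j) \<and> set C \<subseteq> set B \<longleftrightarrow>
    (\<forall>c\<in>set C. c \<in> set B \<and> (\<exists>b\<in>set B. b < c))" (is "?L \<longleftrightarrow> ?R")
proof
  assume L: ?L
  show ?R
  proof
    fix c assume c: "c \<in> set C"
    then obtain j where j: "j < length C" "c = C ! j"
      by (auto simp: in_set_conv_nth)
    then have "B ! j \<in> set B" "B ! j < c"
      using L by auto
    then show "c \<in> set B \<and> (\<exists>b\<in>set B. b < c)"
      using L c by blast
  qed
next
  assume R: ?R
  show ?L
  proof (cases B)
    case Nil
    then show ?thesis using R by (cases C) auto
  next
    case (Cons b B')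
    have sub: "set C \<subseteq> set B'"
      using R B Cons by (auto dest: less_asym)
    have B': "sorted_wrt (<) B'"
      using B Cons by simp
    have seq: "subseq C B'"
      using sub C B' by (intro sorted_subset_imp_subseq strict_sorted_imp_sorted)
    note len = list_emb_length[OF seq]
    have "B ! j < C ! j" if "j < length C" for j
    proof -
      have "B ! j < B ! Suc j"
        using B that len Cons by (intro sorted_wrt_nth_less[of "(<)"]) auto
      also have "\<dots> \<le> C ! j"
        using subseq_nth_le_nth[OF seq B' that] Cons by simp
      finally show ?thesis .
    qed
    then show ?thesis
      using len sub Cons by auto
  qed
qed

lemma N_tableau_iff:
  "N_tableau T \<longleftrightarrow> (\<forall>B\<in>set T. B \<noteq> [] \<and> sorted_wrt (<) B) \<and>
    (\<forall>i. Suc i < length T \<longrightarrow>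
      (\<forall>c\<in>set (T ! Suc i). c \<in> set (T ! i) \<and> (\<exists>b\<in>set (T ! i). b < c)))"
proof -
  have "length (T ! Suc i) \<le> length (T ! i) \<and> (\<forall>j<length (T ! Suc i). T ! i ! j < T ! Suc i ! j) \<and>
      set (T ! Suc i) \<subseteq> set (T ! i) \<longleftrightarrow>
      (\<forall>c\<in>set (T ! Suc i). c \<in> set (T ! i) \<and> (\<exists>b\<in>set (T ! i). b < c))"
    if "\<forall>B\<in>set T. sorted_wrt (<) B" "Suc i < length T" for i
    using that by (intro row_above_iff) auto
  then show ?thesis
    unfolding N_tableau_def tableau_def by (auto simp: strict_sorted_imp_sorted)
qed

lemma N_tableau_Nil [simp]: "N_tableau []"
  by (simp add: N_tableau_iff)

lemma N_tableau_Cons_iff: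
  "N_tableau (B # T) \<longleftrightarrow> B \<noteq> [] \<and> sorted_wrt (<) B \<and> N_tableau T \<and>
    (T \<noteq> [] \<longrightarrow> (\<forall>c\<in>set (hd T). c \<in> set B \<and> (\<exists>b\<in>set B. b < c)))"
proof -
  have all_nat: "(\<forall>i. P i) \<longleftrightarrow> P 0 \<and> (\<forall>i. P (Suc i))" for P :: "nat \<Rightarrow> bool"
    by (metis not0_implies_Suc)
  have "(\<forall>i. Suc i < length (B # T) \<longrightarrow>
        (\<forall>c\<in>set ((B # T) ! Suc i). c \<in> set ((B # T) ! i) \<and> (\<exists>b\<in>set ((B # T) ! i). b < c))) \<longleftrightarrow>
      (T \<noteq> [] \<longrightarrow> (\<forall>c\<in>set (hd T). c \<in> set B \<and> (\<exists>b\<in>set B. b < c))) \<and>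
      (\<forall>i. Suc i < length T \<longrightarrow>
        (\<forall>c\<in>set (T ! Suc i). c \<in> set (T ! i) \<and> (\<exists>b\<in>set (T ! i). b < c)))"
    by (subst all_nat) (simp add: hd_conv_nth)
  then show ?thesis
    unfolding N_tableau_iff by simp blast
qed

lemma N_insert_not_Nil [simp]: "N_insert x T \<noteq> []"
  by (cases T) auto

lemma set_hd_N_insert:
  "set (hd (N_insert x T)) = insert x (if T = [] then {} else set (hd T))"
  by (cases T) auto

text \<open>Rows only grow, and the one letter that the next row may gain is the bumped
  \<open>y\<close>, which lies in the row below together with the smaller letter
  \<open>x\<close>.\<close>

lemma N_tableau_N_insert: "N_tableau T \<Longrightarrow> N_tableau (N_insert x T)"
proof (induction x T rule: N_insert.induct)
  case (1 x)
  then show ?case by (simp add: N_tableau_Cons_iff)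
next
  case (2 x B T)
  then show ?case
    by (fastforce simp: N_tableau_Cons_iff set_hd_N_insert split: option.split
        dest: row_bump_SomeD)
qed

lemma N_insert_in_lists: "x \<in> A \<Longrightarrow> T \<in> lists (lists A) \<Longrightarrow> N_insert x T \<in> lists (lists A)"
  by (induction x T rule: N_insert.induct)
    (auto simp: in_lists_conv_set split: option.splits dest: row_bump_SomeD)

lemma N_tab_Nil [simp]: "N_tab [] = []"
  by (simp add: N_tab_def)

lemma N_tab_snoc [simp]: "N_tab (w @ [x]) = N_insert x (N_tab w)"
  by (simp add: N_tab_def)

lemma N_tableau_N_tab: "N_tableau (N_tab w)"
  by (induction w rule: rev_induct) (auto intro: N_tableau_N_insert)

lemma N_tab_in_N_tableaux: "w \<in> lists A \<Longrightarrow> N_tab w \<in> N_tableaux A"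
  unfolding N_tableaux_def
  by (induction w rule: rev_induct) (auto simp: N_tableau_N_insert N_insert_in_lists)

lemma dec_equiv_row_word_N_tab: "dec_equiv (row_word (N_tab w)) w"
proof (induction w rule: rev_induct)
  case Nil
  then show ?case by (simp add: row_word_def)
next
  case (snoc x w)
  have "dec_equiv (row_word (N_insert x (N_tab w))) (row_word (N_tab w) @ [x])"
    using N_tableau_N_tab by (intro dec_equiv_N_insert) (auto simp: N_tableau_iff)
  also have "dec_equiv \<dots> (w @ [x])"
    using snoc by (rule dec_equiv_append) simp
  finally show ?case by simp
qed

section \<open>Reading off the rows of a tableau\<close>

text \<open>Reversed decreasing subsequences of the row word that take exactly one letter from each
  of the lowest \<open>length c\<close> rows. The length bound keeps \<open>T ! i\<close>
  defined.\<close>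

definition row_chains :: "'a::linorder list list \<Rightarrow> 'a set \<Rightarrow> 'a list set" where
  "row_chains T S = {c. length c \<le> length T \<and> sorted_wrt (<) c \<and> set c \<subseteq> S \<and>
     (\<forall>i<length c. c ! i \<in> set (T ! i))}"

lemma subseq_rev_row_word:
  "length c \<le> length T \<Longrightarrow> \<forall>i<length c. c ! i \<in> set (T ! i) \<Longrightarrow> subseq (rev c) (row_word T)"
proof (induction T arbitrary: c)
  case Nil
  then show ?case by simp
next
  case (Cons B T)
  show ?case
  proof (cases c)
    case Nil
    then show ?thesis by simp
  next
    case (Cons b d)
    then have "subseq (rev d) (row_word T)"
      using Cons.prems by (intro Cons.IH) auto
    moreover have "b \<in> set B"
      using Cons.prems Cons by auto
    ultimately show ?thesis
      using Cons by (auto intro!: list_emb_append_mono simp: subseq_singleton_left)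
  qed
qed

text \<open>As the rows are nested, a chain that skips rows can be pushed down to the first rows.\<close>

lemma subseq_row_word_nth:
  assumes "N_tableau T" "c \<in> dec_subseqs (row_word T) S"
  shows "length c \<le> length T \<and> (\<forall>i<length c. rev c ! i \<in> set (T ! i))"
  using assms
proof (induction T arbitrary: c)
  case Nil
  then have "c = []"
    by (simp add: row_word_def)
  then show ?case by simp
next
  case (Cons B T)
  obtain c1 c2 where c: "c = c1 @ c2" "c1 \<in> dec_subseqs (row_word T) S" "c2 \<in> dec_subseqs B S"
    using Cons.prems(2) by (auto elim: dec_subseqs_appendE)
  have T: "N_tableau T" and B: "sorted_wrt (<) B"
    using Cons.prems by (auto simp: N_tableau_Cons_iff)
  note IH = Cons.IH[OF T c(2)]
  show ?case
  proof (rule dec_subseq_of_row[OF B c(3)])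
    assume c2: "c2 = []"
    have "rev c1 ! i \<in> set ((B # T) ! i)" if "i < length c1" for i
    proof -
      have "set (T ! i) \<subseteq> set ((B # T) ! i)"
        using Cons.prems(1) that IH unfolding N_tableau_iff by auto
      then show ?thesis using IH that by blast
    qed
    then show ?thesis
      using IH c(1) c2 by simp
  next
    fix b assume c2: "c2 = [b]" "b \<in> set B"
    have "(b # rev c1) ! i \<in> set ((B # T) ! i)" if "i < Suc (length c1)" for i
      using that c2 IH by (cases i) auto
    then show ?thesis
      using IH c(1) c2 by simp
  qed
qed

text \<open>Prefixes of chains are chains, so length exactly \<open>k\<close> may be demanded; such
  a prefix uses the lowest \<open>k\<close> rows.\<close>

lemma le_max_dec_row_word_iff:
  assumes "N_tableau T"
  shows "k \<le> max_dec (row_word T) S \<longleftrightarrow> (\<exists>c\<in>row_chains T S. length c = k)"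
proof
  assume "k \<le> max_dec (row_word T) S"
  then obtain c where c: "c \<in> dec_subseqs (row_word T) S" "k \<le> length c"
    using le_max_dec_iff by blast
  then have "take k (rev c) \<in> row_chains T S"
    using subseq_row_word_nth[OF assms c(1)] set_take_subset[of k "rev c"]
    by (auto simp: row_chains_def dec_subseqs_def sorted_wrt_rev intro!: sorted_wrt_take)
  then show "\<exists>c\<in>row_chains T S. length c = k"
    using c(2) by (intro bexI[of _ "take k (rev c)"]) auto
next
  assume "\<exists>c\<in>row_chains T S. length c = k"
  then obtain c where c: "c \<in> row_chains T S" "length c = k" by blast
  then have "rev c \<in> dec_subseqs (row_word T) S"
    using subseq_rev_row_word[of c T]
    by (auto simp: row_chains_def dec_subseqs_def sorted_wrt_rev)
  then show "k \<le> max_dec (row_word T) S"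
    using c le_max_dec_iff by (metis length_rev order_refl)
qed

text \<open>The chain descending from \<open>m\<close> by taking predecessors in the successive lower rows is
  extremal: among the chains starting at or above its least letter \<open>z\<close>, none ends below \<open>m\<close>.\<close>

lemma extremal_row_chain:
  assumes "N_tableau T" "k < length T" "m \<in> set (T ! k)"
  shows "\<exists>z. (\<exists>c\<in>row_chains T {z..m}. length c = Suc k) \<and>
    (\<forall>c\<in>row_chains T {z..}. length c = Suc k \<longrightarrow> m \<le> last c)"
  using assms(2,3)
proof (induction k arbitrary: m)
  case 0
  then have "[m] \<in> row_chains T {m..m}"
    by (auto simp: row_chains_def Suc_le_eq)
  moreover have "m \<le> last c" if "c \<in> row_chains T {m..}" "length c = Suc 0" for c
    using that by (auto simp: row_chains_def length_Suc_conv)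
  ultimately show ?case
    by (intro exI[of _ m]) (auto intro!: bexI[of _ "[m]"])
next
  case (Suc k)
  \<comment> \<open>The predecessor of \<open>m\<close> in the row below; it exists because
    \<open>m\<close> has a smaller letter there.\<close>
  define p where "p = Max {a \<in> set (T ! k). a < m}"
  have nested: "\<forall>c\<in>set (T ! Suc k). c \<in> set (T ! k) \<and> (\<exists>b\<in>set (T ! k). b < c)"
    using assms(1) Suc.prems unfolding N_tableau_iff by blast
  then have "{a \<in> set (T ! k). a < m} \<noteq> {}"
    using Suc.prems by auto
  then have p: "p \<in> set (T ! k)" "p < m"
    using Max_in[of "{a \<in> set (T ! k). a < m}"] by (auto simp: p_def)
  have p_max: "a \<le> p" if "a \<in> set (T ! k)" "a < m" for a
    using that by (simp add: p_def)
  obtain z c where c: "c \<in> row_chains T {z..p}" "length c = Suc k"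
    and z: "\<And>c. c \<in> row_chains T {z..} \<Longrightarrow> length c = Suc k \<Longrightarrow> p \<le> last c"
    using Suc.IH[OF _ p(1)] Suc.prems(1) by auto
  \<comment> \<open>The chain is nonempty, so \<open>{z..p}\<close> is too; hence \<open>m\<close>,
    being above \<open>p\<close>, lies in \<open>{z..m}\<close>.\<close>
  have "c ! 0 \<in> set c"
    using c by simp
  then have "c ! 0 \<in> {z..p}"
    using c(1) unfolding row_chains_def by blast
  then have "z \<le> p"
    by auto
  moreover have "set c \<subseteq> {z..p}"
    using c(1) by (simp add: row_chains_def)
  then have "a < m" "z \<le> a" if "a \<in> set c" for a
    using that p(2) by (meson atLeastAtMost_iff order_le_less_trans subsetD)+
  then have "\<forall>a\<in>set c. a < m" "set c \<subseteq> {z..m}"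
    by (simp_all add: subset_eq less_imp_le)
  ultimately have "c @ [m] \<in> row_chains T {z..m}"
    using c p(2) Suc.prems
    by (auto simp: row_chains_def sorted_wrt_append nth_append less_Suc_eq)
  \<comment> \<open>Without its last letter \<open>a\<close>, the chain \<open>d\<close> ends at or
    above \<open>p\<close>, so \<open>a > p\<close>. By nesting \<open>a\<close> is also in row
    \<open>k\<close>, where no letter lies strictly between \<open>p\<close> and
    \<open>m\<close>.\<close>
  moreover have "m \<le> last d" if d: "d \<in> row_chains T {z..}" "length d = Suc (Suc k)" for d
  proof -
    obtain e a where e: "d = e @ [a]"
      using d by (metis length_0_conv nat.distinct(1) rev_exhaust)
    have e': "e \<in> row_chains T {z..}" "length e = Suc k"
      using d e by (auto simp: row_chains_def sorted_wrt_append nth_append split: if_splits)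
    have "last e < a"
      using d e e' last_in_set[of e] by (fastforce simp: row_chains_def sorted_wrt_append)
    then have "p < a"
      using z[OF e'] by simp
    moreover have "d ! Suc k \<in> set (T ! Suc k)"
      using d by (simp add: row_chains_def)
    then have "a \<in> set (T ! Suc k)"
      using e e' by (simp add: nth_append)
    then have "a \<in> set (T ! k)"
      using nested by blast
    ultimately show ?thesis
      using p_max[of a] e by (auto simp: not_less[symmetric])
  qed
  ultimately show ?case
    using c(2) by (intro exI[of _ z]) (auto intro!: bexI[of _ "c @ [m]"])
qed

text \<open>Row indices start at 0, hence \<open>Suc k\<close>. An extremal chain supplies
  \<open>z\<close>. Conversely, a chain of length \<open>Suc k\<close> in \<open>{z..m}\<close> that
  does not fit into \<open>{z..<m}\<close> must end in \<open>m\<close>, and its last letter lies in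
  row \<open>k\<close>.\<close>

lemma in_row_iff:
  assumes "N_tableau T"
  shows "k < length T \<and> m \<in> set (T ! k) \<longleftrightarrow>
    (\<exists>z. max_dec (row_word T) {z..<m} < Suc k \<and> Suc k \<le> max_dec (row_word T) {z..m})"
    (is "?L \<longleftrightarrow> ?R")
proof
  assume ?L
  then obtain z where z: "\<exists>c\<in>row_chains T {z..m}. length c = Suc k"
      "\<forall>c\<in>row_chains T {z..}. length c = Suc k \<longrightarrow> m \<le> last c"
    using extremal_row_chain[OF assms] by blast
  have "\<not> (\<exists>c\<in>row_chains T {z..<m}. length c = Suc k)"
  proof
    assume "\<exists>c\<in>row_chains T {z..<m}. length c = Suc k"
    then obtain c where c: "c \<in> row_chains T {z..<m}" "length c = Suc k" by blast
    then have "c \<in> row_chains T {z..}" by (auto simp: row_chains_def)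
    then have "m \<le> last c" using z c by blast
    moreover have "last c \<in> set c" using c(2) by (intro last_in_set) auto
    ultimately show False using c(1) by (force simp: row_chains_def)
  qed
  then show ?R
    using z(1) by (auto simp: le_max_dec_row_word_iff[OF assms] not_le[symmetric])
next
  assume ?R
  then obtain z c where c: "c \<in> row_chains T {z..m}" "length c = Suc k"
    and no: "\<not> (\<exists>c\<in>row_chains T {z..<m}. length c = Suc k)"
    by (auto simp: le_max_dec_row_word_iff[OF assms] not_le[symmetric])
  obtain d a where d: "c = d @ [a]"
    using c by (metis length_0_conv nat.distinct(1) rev_exhaust)
  have "a = m"
  proof (rule ccontr)
    assume "a \<noteq> m"
    then have "c \<in> row_chains T {z..<m}"
      using c d by (fastforce simp: row_chains_def sorted_wrt_append)
    then show False using no c by blast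
  qed
  then have "c ! k = m"
    using c d by (simp add: nth_append)
  then show ?L
    using c by (auto simp: row_chains_def)
qed

text \<open>Membership in rows is expressed by \<open>max_dec\<close> on intervals. Since rows are
  nonempty, membership also determines the height, and a strictly increasing row is determined by
  its set.\<close>

lemma N_tableau_eqI:
  assumes T: "N_tableau T" and U: "N_tableau U" and "dec_equiv (row_word T) (row_word U)"
  shows "T = U"
proof -
  have same: "k < length T \<and> m \<in> set (T ! k) \<longleftrightarrow> k < length U \<and> m \<in> set (U ! k)" for k m
    using assms(3) unfolding in_row_iff[OF T] in_row_iff[OF U] by (simp add: dec_equiv_def)
  have ne: "\<exists>m. m \<in> set (T ! k)" if "k < length T" "N_tableau T" for k and T :: "'a list list"
    using that unfolding N_tableau_iff by (meson last_in_set nth_mem)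
  have len: "k < length T \<longleftrightarrow> k < length U" for k
    using same[of k] ne[of k] T U by metis
  show ?thesis
  proof (rule nth_equalityI)
    show "length T = length U"
      using len by (metis linorder_neqE_nat nat_neq_iff)
    fix k assume k: "k < length T"
    then have "set (T ! k) = set (U ! k)"
      using same[of k] len[of k] by blast
    moreover have "sorted_wrt (<) (T ! k)" "sorted_wrt (<) (U ! k)"
      using T U k len[of k] unfolding N_tableau_iff by auto
    ultimately show "T ! k = U ! k"
      by (metis strict_sorted_equal)
  qed
qed

section \<open>The action on columns\<close>

text \<open>The count in a down-set obeys the recursion of longest decreasing sequences: either
  ignore \<open>x\<close>, or put \<open>x\<close> in front of letters below it. If \<open>x\<close>
  and the replaced \<open>y\<close> are both in \<open>I\<close>, the count stays and already
  exceeds the number of letters below \<open>x\<close>; if only \<open>x\<close> is in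
  \<open>I\<close>, it grows by one.\<close>

lemma card_letter_act_Int:
  assumes "finite \<gamma>" and I: "\<And>a b. a \<in> I \<Longrightarrow> b \<le> a \<Longrightarrow> b \<in> I"
  shows "card (letter_act x \<gamma> \<inter> I) =
    (if x \<in> I then max (card (\<gamma> \<inter> I)) (Suc (card (\<gamma> \<inter> {..<x}))) else card (\<gamma> \<inter> I))"
proof (cases "\<forall>y\<in>\<gamma>. y < x")
  case True
  then have \<gamma>: "\<gamma> \<inter> {..<x} = \<gamma>" "x \<notin> \<gamma>" by auto
  show ?thesis
  proof (cases "x \<in> I")
    case x: True
    then have "\<gamma> \<inter> I = \<gamma>" using True I by fastforce
    moreover have "letter_act x \<gamma> \<inter> I = insert x (\<gamma> \<inter> I)"
      using True x by (auto simp: letter_act_def)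
    ultimately show ?thesis using \<gamma> x assms(1) by simp
  next
    case False
    then have "letter_act x \<gamma> \<inter> I = \<gamma> \<inter> I"
      using True by (auto simp: letter_act_def)
    then show ?thesis using False by simp
  qed
next
  case False
  define y where "y = Min {y \<in> \<gamma>. x \<le> y}"
  have "{y \<in> \<gamma>. x \<le> y} \<noteq> {}" using False by (auto simp: not_less)
  then have y: "y \<in> \<gamma>" "x \<le> y"
    using Min_in[of "{y \<in> \<gamma>. x \<le> y}"] assms(1) by (auto simp: y_def)
  have y_min: "y \<le> b" if "b \<in> \<gamma>" "x \<le> b" for b
    using that assms(1) by (simp add: y_def)
  have act: "letter_act x \<gamma> = insert x (\<gamma> - {y})"
    using False by (auto simp: letter_act_def y_def)
  have x: "x \<notin> \<gamma> - {y}" using y y_min by fastforce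
  have fin: "finite (\<gamma> \<inter> I)" using assms(1) by simp
  consider "x \<notin> I" | "y \<in> I" | "x \<in> I" "y \<notin> I" by blast
  then show ?thesis
  proof cases
    case 1
    then have "y \<notin> I" using I y by blast
    then have "letter_act x \<gamma> \<inter> I = \<gamma> \<inter> I" using 1 act by auto
    then show ?thesis using 1 by simp
  next
    case 2
    then have xI: "x \<in> I" using I y by blast
    then have "letter_act x \<gamma> \<inter> I = insert x (\<gamma> \<inter> I - {y})" using act by auto
    moreover have "x \<notin> \<gamma> \<inter> I - {y}" using x by auto
    ultimately have "card (letter_act x \<gamma> \<inter> I) = Suc (card (\<gamma> \<inter> I - {y}))"
      by (metis card_insert_disjoint fin finite_Diff)
    also have "\<dots> = card (\<gamma> \<inter> I)"
      using fin 2 y by (intro card_Suc_Diff1) auto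
    finally have "card (letter_act x \<gamma> \<inter> I) = card (\<gamma> \<inter> I)" .
    moreover have "{..<x} \<subseteq> I" "y \<notin> {..<x}"
      using I[OF xI] less_imp_le y(2) by auto
    then have "\<gamma> \<inter> {..<x} \<subset> \<gamma> \<inter> I"
      using 2 y(1) by blast
    then have "card (\<gamma> \<inter> {..<x}) < card (\<gamma> \<inter> I)"
      by (rule psubset_card_mono[OF fin])
    ultimately show ?thesis using xI by simp
  next
    case 3
    \<comment> \<open>Letters of \<open>\<gamma>\<close> that are at least \<open>x\<close> are at
      least \<open>y\<close>, hence outside the down-set \<open>I\<close>.\<close>
    have "b \<in> I \<longleftrightarrow> b < x" if "b \<in> \<gamma>" for b
      using that y_min[of b] I[of b y] I[of x b] 3
      by (cases "b < x") (auto simp: not_less dest: leD)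
    then have eq: "\<gamma> \<inter> I = \<gamma> \<inter> {..<x}"
      by auto
    have "letter_act x \<gamma> \<inter> I = insert x (\<gamma> \<inter> I)" using 3 act by auto
    moreover have "x \<notin> \<gamma> \<inter> I" using eq by auto
    ultimately show ?thesis using 3 fin eq by simp
  qed
qed

lemma finite_letter_act: "finite \<gamma> \<Longrightarrow> finite (letter_act x \<gamma>)"
  by (simp add: letter_act_def)

lemma finite_word_act: "finite \<gamma> \<Longrightarrow> finite (word_act w \<gamma>)"
  unfolding word_act_def by (induction w) (auto intro: finite_letter_act)

text \<open>The right side measures decreasing subsequences of the word \<open>w \<gamma>\<close>: a
  part \<open>c\<close> from \<open>w\<close>, continued by all letters of \<open>\<gamma>\<close>
  in \<open>I\<close> below it. The head of \<open>w\<close> acts last, so induction on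
  \<open>w\<close> matches the recursion for one letter.\<close>

lemma le_card_word_act_iff:
  assumes "finite \<gamma>" and I: "\<forall>a\<in>I. {..a} \<subseteq> I"
  shows "k \<le> card (word_act w \<gamma> \<inter> I) \<longleftrightarrow>
    (\<exists>c\<in>dec_subseqs w I. k \<le> length c + card {g \<in> \<gamma> \<inter> I. \<forall>x\<in>set c. g < x})"
  using I
proof (induction w arbitrary: k I)
  case Nil
  then show ?case by (simp add: word_act_def Int_def)
next
  case (Cons x w)
  have down: "b \<in> I" if "a \<in> I" "b \<le> a" for a b
    using Cons.prems that by auto
  have "\<forall>a\<in>{..<x}. {..a} \<subseteq> {..<x}" by auto
  \<comment> \<open>If \<open>x\<close> is used, the rest must lie below \<open>x\<close> and one
    letter less is required. Truncated \<open>k - 1\<close> is harmless: for \<open>k = 0\<close>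
    both sides hold.\<close>
  note IH = Cons.IH[OF Cons.prems, of k] Cons.IH[OF this, of "k - 1"]
  let ?P = "\<lambda>k I c. k \<le> length c + card {g \<in> \<gamma> \<inter> I. \<forall>x\<in>set c. g < x}"
  have "k \<le> card (word_act (x # w) \<gamma> \<inter> I) \<longleftrightarrow>
      k \<le> card (word_act w \<gamma> \<inter> I) \<or> x \<in> I \<and> k - 1 \<le> card (word_act w \<gamma> \<inter> {..<x})"
    using card_letter_act_Int[OF finite_word_act[OF assms(1), of w] down, where x = x]
    by (auto simp: word_act_def)
  also have "\<dots> \<longleftrightarrow> (\<exists>c\<in>dec_subseqs w I. ?P k I c) \<or>
      x \<in> I \<and> (\<exists>c\<in>dec_subseqs w {..<x}. ?P (k - 1) {..<x} c)"
    unfolding IH ..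
  also have "\<dots> \<longleftrightarrow> (\<exists>c\<in>dec_subseqs (x # w) I. ?P k I c)"
  proof -
    have set_eq: "{g \<in> \<gamma> \<inter> {..<x}. \<forall>y\<in>set c. g < y} = {g \<in> \<gamma> \<inter> I. \<forall>y\<in>set (x # c). g < y}"
      if "x \<in> I" for c
      using down[OF that] by auto
    have P_eq: "?P (k - 1) {..<x} c \<longleftrightarrow> ?P k I (x # c)" if "x \<in> I" for c
      unfolding set_eq[OF that] by auto
    have sub: "c \<in> dec_subseqs (x # w) I \<longleftrightarrow>
        c \<in> dec_subseqs w I \<or> x \<in> I \<and> (\<exists>d\<in>dec_subseqs w {..<x}. c = x # d)" for c
    proof
      assume c: "c \<in> dec_subseqs (x # w) I"
      then have "subseq c (x # w)" by (simp add: dec_subseqs_def)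
      then show "c \<in> dec_subseqs w I \<or> x \<in> I \<and> (\<exists>d\<in>dec_subseqs w {..<x}. c = x # d)"
        using c by (cases rule: list_emb.cases) (auto simp: dec_subseqs_def)
    next
      assume "c \<in> dec_subseqs w I \<or> x \<in> I \<and> (\<exists>d\<in>dec_subseqs w {..<x}. c = x # d)"
      then show "c \<in> dec_subseqs (x # w) I"
        using down[of x] by (fastforce simp: dec_subseqs_def)
    qed
    show ?thesis
      unfolding Bex_def sub using P_eq by blast
  qed
  finally show ?case .
qed

lemma distinct_if_dec: "sorted_wrt (>) c \<Longrightarrow> distinct c" for c :: "'a::linorder list"
  by (induction c) auto

text \<open>Test the action on the column \<open>\<gamma>\<close> of all letters of \<open>A\<close>
  below \<open>S\<close>, counting in the down-closure \<open>I\<close> of \<open>S\<close>. Every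
  sequence in \<open>S\<close> can be continued by all of \<open>\<gamma>\<close>; conversely,
  letters outside \<open>S\<close> contribute at most \<open>card \<gamma>\<close> and can be
  discarded.\<close>

lemma max_dec_le_if_styl_equiv:
  assumes A: "finite A" and uv: "styl_equiv A u v"
    and S: "order_convex S" and v: "v \<in> lists A"
  shows "max_dec u S \<le> max_dec v S"
\<comment> \<open>For empty \<open>S\<close> the set \<open>I\<close> would be empty, and
  \<open>\<gamma>\<close> need not lie inside it.\<close>
proof (cases "S = {}")
  case True
  then show ?thesis by (intro max_dec_leI) (auto simp: dec_subseqs_def)
next
  case False
  define \<gamma> where "\<gamma> = {a \<in> A. \<forall>b\<in>S. a < b}"
  define I where "I = {a. \<exists>b\<in>S. a \<le> b}"
  have I: "\<forall>a\<in>I. {..a} \<subseteq> I"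
    unfolding I_def by (auto intro: order_trans)
  have \<gamma>: "\<gamma> \<subseteq> A" "finite \<gamma>" "\<gamma> \<inter> I = \<gamma>"
    using A False by (auto simp: \<gamma>_def I_def intro: less_imp_le)
  have SI: "S \<subseteq> I"
    by (auto simp: I_def)
  have cover: "A \<inter> I \<subseteq> S \<union> \<gamma>"
  proof
    fix a assume a: "a \<in> A \<inter> I"
    then obtain b where b: "b \<in> S" "a \<le> b"
      by (auto simp: I_def)
    show "a \<in> S \<union> \<gamma>"
    proof (cases "\<forall>b\<in>S. a < b")
      case False
      then obtain b' where "b' \<in> S" "b' \<le> a"
        by (auto simp: not_less)
      then show ?thesis
        using order_convexD[OF S _ b(1) _ b(2)] by blast
    qed (use a in \<open>simp add: \<gamma>_def\<close>)
  qed
  show ?thesis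
  proof (rule max_dec_leI)
    fix c assume c: "c \<in> dec_subseqs u S"
    then have "{g \<in> \<gamma> \<inter> I. \<forall>x\<in>set c. g < x} = \<gamma>"
      using \<gamma> by (auto simp: dec_subseqs_def \<gamma>_def)
    moreover have "c \<in> dec_subseqs u I"
      using c SI by (auto simp: dec_subseqs_def)
    ultimately have "length c + card \<gamma> \<le> card (word_act u \<gamma> \<inter> I)"
      unfolding le_card_word_act_iff[OF \<gamma>(2) I] by (intro bexI[of _ c]) simp_all
    also have "word_act u \<gamma> = word_act v \<gamma>"
      using uv \<gamma>(1) by (auto simp: styl_equiv_def columns_def)
    finally obtain d where d: "d \<in> dec_subseqs v I"
        "length c + card \<gamma> \<le> length d + card {g \<in> \<gamma>. \<forall>x\<in>set d. g < x}"
      unfolding le_card_word_act_iff[OF \<gamma>(2) I] \<gamma>(3) by blast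
    have d': "subseq d v" "sorted_wrt (>) d" "set d \<subseteq> I"
      using d(1) by (auto simp: dec_subseqs_def)
    then have "set d \<subseteq> A \<inter> I"
      using v list_emb_set[OF d'(1)] by auto
    with cover have d_set: "set d \<subseteq> S \<union> \<gamma>"
      by (rule order_trans[rotated])
    have len: "length (filter P d) = card {x \<in> set d. P x}" for P
      using distinct_card[OF distinct_filter[OF distinct_if_dec[OF d'(2)]]] by simp
    \<comment> \<open>Letters of \<open>d\<close> outside \<open>S\<close> belong to
      \<open>\<gamma>\<close> and are distinct from those below all of \<open>d\<close>, so together
      they number at most \<open>card \<gamma>\<close>.\<close>
    have "card {x \<in> set d. x \<notin> S} + card {g \<in> \<gamma>. \<forall>x\<in>set d. g < x} =
        card ({x \<in> set d. x \<notin> S} \<union> {g \<in> \<gamma>. \<forall>x\<in>set d. g < x})"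
      using \<gamma>(2) by (subst card_Un_disjoint) auto
    also have "\<dots> \<le> card \<gamma>"
      using \<gamma>(2) d_set by (intro card_mono) auto
    finally have "length c \<le> length (filter (\<lambda>x. x \<in> S) d)"
      using d(2) sum_length_filter_compl[of "\<lambda>x. x \<in> S" d] len[of "\<lambda>x. x \<notin> S"] by simp
    moreover have "subseq (filter (\<lambda>x. x \<in> S) d) v"
      using subseq_filter_left d'(1) by (rule subseq_order.trans)
    then have "filter (\<lambda>x. x \<in> S) d \<in> dec_subseqs v S"
      using d'(2) by (auto simp: dec_subseqs_def sorted_wrt_filter)
    ultimately show "length c \<le> max_dec v S"
      using le_max_dec_iff by blast
  qed
qed

text \<open>Replace an optimal \<open>c\<close> by some \<open>d\<close> in the convex set
  \<open>{last c..t}\<close>: it is no shorter, and every letter of \<open>\<gamma>\<close> below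
  \<open>c\<close> remains below \<open>d\<close>.\<close>

lemma card_word_act_le_if_dec_equiv:
  assumes uv: "dec_equiv u v" and "finite \<gamma>"
  shows "card (word_act u \<gamma> \<inter> {..t}) \<le> card (word_act v \<gamma> \<inter> {..t})"
proof -
  have I: "\<forall>a\<in>{..t}. {..a} \<subseteq> {..t}" by auto
  note iff = le_card_word_act_iff[OF assms(2) I]
  obtain c where c: "c \<in> dec_subseqs u {..t}"
    "card (word_act u \<gamma> \<inter> {..t}) \<le> length c + card {g \<in> \<gamma> \<inter> {..t}. \<forall>x\<in>set c. g < x}"
    using order_refl[of "card (word_act u \<gamma> \<inter> {..t})"] unfolding iff by blast
  show ?thesis
  proof (cases "c = []")
    case True
    then show ?thesis
      unfolding iff using c(2) by (intro bexI[of _ "[]"]) simp_all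
  next
    case False
    let ?z = "last c"
    have "\<forall>a\<in>set c. ?z \<le> a"
      using c(1) last_le_if_dec by (auto simp: dec_subseqs_def)
    then have "c \<in> dec_subseqs u {?z..t}"
      using c(1) by (auto simp: dec_subseqs_def)
    then obtain d where d: "d \<in> dec_subseqs v {?z..t}" "length c \<le> length d"
      using dec_equivE[OF uv order_convex_intervals(3)] by blast
    have "g < x" if "\<forall>x\<in>set c. g < x" "x \<in> set d" for g x
    proof -
      have "g < ?z"
        using that(1) False by simp
      also have "?z \<le> x"
        using d(1) that(2) by (auto simp: dec_subseqs_def)
      finally show ?thesis .
    qed
    then have "card {g \<in> \<gamma> \<inter> {..t}. \<forall>x\<in>set c. g < x} \<le> card {g \<in> \<gamma> \<inter> {..t}. \<forall>x\<in>set d. g < x}"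
      using assms(2) by (intro card_mono) auto
    moreover have "d \<in> dec_subseqs v {..t}"
      using d(1) by (auto simp: dec_subseqs_def)
    ultimately show ?thesis
      unfolding iff using c(2) d(2) by (intro bexI[of _ d]) linarith
  qed
qed

text \<open>Below the least element \<open>t\<close> of the symmetric difference the sets agree, so
  their counts up to \<open>t\<close> would differ.\<close>

lemma finite_set_eqI_card_atMost:
  fixes X Y :: "'a::linorder set"
  assumes "finite X" "finite Y" and card: "\<And>t. card (X \<inter> {..t}) = card (Y \<inter> {..t})"
  shows "X = Y"
proof (rule ccontr)
  assume "X \<noteq> Y"
  define t where "t = Min (X - Y \<union> (Y - X))"
  have fin: "finite (X - Y \<union> (Y - X))" and "X - Y \<union> (Y - X) \<noteq> {}"
    using assms \<open>X \<noteq> Y\<close> by auto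
  then have t: "t \<in> X - Y \<union> (Y - X)"
    unfolding t_def by (rule Min_in)
  have below: "a \<in> X \<longleftrightarrow> a \<in> Y" if "a < t" for a
    using that Min_le[OF fin, of a] by (auto simp: t_def not_le[symmetric])
  consider "t \<in> X" "t \<notin> Y" | "t \<in> Y" "t \<notin> X" using t by blast
  then show False
  proof cases
    case 1
    then have "Y \<inter> {..t} \<subset> X \<inter> {..t}" using below by (auto simp: le_less)
    then show False using card[of t] assms(1) by (metis finite_Int nat_neq_iff psubset_card_mono)
  next
    case 2
    then have "X \<inter> {..t} \<subset> Y \<inter> {..t}" using below by (auto simp: le_less)
    then show False using card[of t] assms(2) by (metis finite_Int nat_neq_iff psubset_card_mono)
  qed
qed

section \<open>Comparison of the two equivalences and the bijection\<close>

lemma styl_equiv_iff_dec_equiv: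
  assumes A: "finite A" and u: "u \<in> lists A" and v: "v \<in> lists A"
  shows "styl_equiv A u v \<longleftrightarrow> dec_equiv u v"
proof
  assume uv: "styl_equiv A u v"
  then have vu: "styl_equiv A v u"
    by (simp add: styl_equiv_def)
  show "dec_equiv u v"
    unfolding dec_equiv_def
    using max_dec_le_if_styl_equiv[OF A uv _ v] max_dec_le_if_styl_equiv[OF A vu _ u]
    by (blast intro: le_antisym)
next
  assume uv: "dec_equiv u v"
  have "word_act u \<gamma> = word_act v \<gamma>" if "finite \<gamma>" for \<gamma>
    using that finite_word_act card_word_act_le_if_dec_equiv[OF uv that]
      card_word_act_le_if_dec_equiv[OF dec_equiv_sym[OF uv] that]
    by (intro finite_set_eqI_card_atMost) (auto intro: le_antisym)
  then show "styl_equiv A u v"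
    using A unfolding styl_equiv_def columns_def by (auto dest: finite_subset)
qed

lemma N_tab_eq_iff_dec_equiv: "N_tab u = N_tab v \<longleftrightarrow> dec_equiv u v"
proof
  assume "N_tab u = N_tab v"
  then show "dec_equiv u v"
    using dec_equiv_row_word_N_tab[of u] dec_equiv_row_word_N_tab[of v]
    by (metis dec_equiv_sym dec_equiv_trans)
next
  assume "dec_equiv u v"
  then have "dec_equiv (row_word (N_tab u)) (row_word (N_tab v))"
    using dec_equiv_row_word_N_tab[of u] dec_equiv_row_word_N_tab[of v]
    by (metis dec_equiv_sym dec_equiv_trans)
  then show "N_tab u = N_tab v"
    by (intro N_tableau_eqI N_tableau_N_tab)
qed

text \<open>This gives surjectivity: \<open>row_word T\<close> is equivalent to the row word of its
  own \<open>N_tab\<close>, and equivalent row words force equal \<open>N\<close>-tableaux.\<close>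

lemma N_tab_row_word: "N_tableau T \<Longrightarrow> N_tab (row_word T) = T"
  by (intro N_tableau_eqI N_tableau_N_tab dec_equiv_row_word_N_tab)

lemma styl_map_eq_iff: "styl_map A u = styl_map A v \<longleftrightarrow> styl_equiv A u v"
  unfolding styl_map_def styl_equiv_def by (auto simp: fun_eq_iff restrict_def)

theorem theorem7p1:
  fixes A :: "'a::linorder set"
  assumes "finite A"
  shows "N_tab \<in> lists A \<rightarrow> N_tableaux A \<and>
    (\<exists>\<Phi>. bij_betw \<Phi> (carrier (Styl A)) (N_tableaux A) \<and>
         (\<forall>w\<in>lists A. \<Phi> (styl_map A w) = N_tab w)) \<and>
    (\<forall>u\<in>lists A. \<forall>v\<in>lists A. N_tab u = N_tab v \<longleftrightarrow> styl_equiv A u v) \<and>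
    (\<forall>T\<in>N_tableaux A. \<exists>w\<in>lists A. N_tab w = T)"
proof -
  have into: "N_tab \<in> lists A \<rightarrow> N_tableaux A"
    by (intro funcsetI N_tab_in_N_tableaux)
  have eq: "N_tab u = N_tab v \<longleftrightarrow> styl_equiv A u v" if "u \<in> lists A" "v \<in> lists A" for u v
    using that by (simp add: styl_equiv_iff_dec_equiv[OF assms] N_tab_eq_iff_dec_equiv)
  have onto: "\<exists>w\<in>lists A. N_tab w = T" if "T \<in> N_tableaux A" for T
  proof
    show "N_tab (row_word T) = T"
      using that by (simp add: N_tableaux_def N_tab_row_word)
    show "row_word T \<in> lists A"
      using that by (auto simp: N_tableaux_def row_word_def in_lists_conv_set)
  qed
  \<comment> \<open>An arbitrary representing word is chosen; \<open>eq\<close> makes the value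
    independent of the choice.\<close>
  define \<Phi> where "\<Phi> f = N_tab (SOME w. w \<in> lists A \<and> styl_map A w = f)" for f
  have \<Phi>: "\<Phi> (styl_map A w) = N_tab w" if "w \<in> lists A" for w
  proof -
    let ?w = "SOME w'. w' \<in> lists A \<and> styl_map A w' = styl_map A w"
    have "?w \<in> lists A \<and> styl_map A ?w = styl_map A w"
      by (rule someI[of "\<lambda>w'. w' \<in> lists A \<and> styl_map A w' = styl_map A w" w]) (simp add: that)
    then show ?thesis
      using eq[of ?w w] that by (simp add: \<Phi>_def styl_map_eq_iff)
  qed
  have carrier: "carrier (Styl A) = styl_map A ` lists A"
    by (simp add: Styl_def)
  have bij: "bij_betw \<Phi> (carrier (Styl A)) (N_tableaux A)"
    unfolding bij_betw_def carrier
  proof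
    show "inj_on \<Phi> (styl_map A ` lists A)"
    proof (rule inj_onI, elim imageE)
      fix f g u v
      assume "\<Phi> f = \<Phi> g" "f = styl_map A u" "u \<in> lists A" "g = styl_map A v" "v \<in> lists A"
      then show "f = g"
        by (simp only: \<Phi> eq styl_map_eq_iff)
    qed
    have "\<Phi> ` styl_map A ` lists A = N_tab ` lists A"
      unfolding image_image by (rule image_cong[OF refl \<Phi>])
    also have "\<dots> = N_tableaux A"
      using into onto by blast
    finally show "\<Phi> ` styl_map A ` lists A = N_tableaux A" .
  qed
  show ?thesis
  proof (intro conjI exI ballI)
    show "N_tab \<in> lists A \<rightarrow> N_tableaux A" by (fact into)
    show "bij_betw \<Phi> (carrier (Styl A)) (N_tableaux A)" by (fact bij)
  qed (rule \<Phi> eq onto; assumption)+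
qed

end
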